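(* Let $p\ge 1$ and let $\{X_{t,N}\}_t$ be a tvARCH$(p)$ process with parameter functions $a_0,\dots,a_p$ and innovations $\{Z_t\}$. Assume: (i) there exist $0<\rho_1\le\rho_2<\infty$ and $0<\delta_0<1$ such that $\rho_1\le a_0(u)\le\rho_2$ for all $u\in(0,1]$ and $\sup_u\sum_{j=1}^p a_j(u)\le 1-\delta_0$; (ii) there exist $\beta\in(0,1]$ and a finite constant $K_0>0$ such that $|a_j(u)-a_j(v)|\le K_0|u-v|^\beta$ for all $u,v\in(0,1]$ and each $j=0,1,\dots,p$; and, for some $0<\delta<1$, $\{\mathbb{E}(Z_t^4)\}^{1/2}\sup_u\sum_{j=1}^p a_j(u)\le 1-\delta$. Then there exist $\rho\in(1-\delta,1)$ and a finite constant $K>0$, not depending on $h$, such that for every integer $h\ge 0$, $$\sup_{t,N}\big|\operatorname{cov}\{X_{t,N}^2,X_{t+h,N}^2\}\big|\le K\rho^h,$$ where the supremum is over all $N$ and all $t$ with $1\le t$ and $t+h\le N$.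
   Context: tvARCH$(p)$ process: $a_0,\dots,a_p:(0,1]\to[0,\infty)$ are functions and $\{Z_t\}_{t\in\mathbb{Z}}$ are independent and identically distributed real random variables with $\mathbb{E}(Z_t)=0$ and $\mathbb{E}(Z_t^2)=1$. For each $N\ge1$, the process $\{X_{t,N}\}$ satisfies, for $t=1,\dots,N$, $$X_{t,N}=\sigma_{t,N}Z_t,\qquad \sigma_{t,N}^2=a_0\Big(\frac tN\Big)+\sum_{j=1}^p a_j\Big(\frac tN\Big)X_{t-j,N}^2 .$$ Convention: the recursion is extended to $t\le 0$ with $a_j(t/N)$ replaced by $\lim_{u\downarrow0}a_j(u)$, and $X_{t,N}$ is the causal solution (a function of $Z_t,Z_{t-1},\dots$) with bounded second moments. *)

theory Defs
  imports "HOL-Probability.Probability"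
begin

text \<open>
  For \<open>t \<le> 0\<close> the parameter function is frozen at its right limit at \<open>0\<close>, which exists
  whenever \<open>f\<close> is Hoelder continuous on \<open>(0,1]\<close>.
\<close>

definition tv_coeff :: "(real \<Rightarrow> real) \<Rightarrow> nat \<Rightarrow> int \<Rightarrow> real" where
  "tv_coeff f N t =
    (if t \<le> 0 then Lim (at_right 0) f else f (real_of_int t / real N))"

text \<open>
  \<open>X N t\<close> and \<open>\<sigma> N t\<close> stand for \<open>X\<close> and \<open>\<sigma>\<close> with index \<open>(t,N)\<close>; their values for
  \<open>N = 0\<close> and for \<open>t > N\<close> are irrelevant. All identities between random variables hold
  almost surely. Causality means that \<open>X N t\<close> is a measurable function of
  \<open>Z t, Z (t - 1), \<dots>\<close>. The bound on the second moments may depend on \<open>N\<close>.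
\<close>

locale tvARCH = prob_space M
  for M :: "'a measure"
  and p :: nat
  and a :: "nat \<Rightarrow> real \<Rightarrow> real"
  and Z :: "int \<Rightarrow> 'a \<Rightarrow> real"
  and \<sigma> :: "nat \<Rightarrow> int \<Rightarrow> 'a \<Rightarrow> real"
  and X :: "nat \<Rightarrow> int \<Rightarrow> 'a \<Rightarrow> real" +
  assumes coeff_nonneg: "\<And>j u. j \<le> p \<Longrightarrow> 0 < u \<Longrightarrow> u \<le> 1 \<Longrightarrow> 0 \<le> a j u"
    and Z_indep: "indep_vars (\<lambda>_. borel) Z UNIV"
    and Z_ident: "\<And>s t. distr M borel (Z s) = distr M borel (Z t)"
    and Z_integrable: "\<And>t. integrable M (Z t)"
    and Z_mean: "\<And>t. expectation (Z t) = 0"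
    and Z_square_integrable: "\<And>t. integrable M (\<lambda>\<omega>. (Z t \<omega>)\<^sup>2)"
    and Z_second_moment: "\<And>t. expectation (\<lambda>\<omega>. (Z t \<omega>)\<^sup>2) = 1"
    and X_measurable: "\<And>N t. 1 \<le> N \<Longrightarrow> t \<le> int N \<Longrightarrow> random_variable borel (X N t)"
    and \<sigma>_measurable: "\<And>N t. 1 \<le> N \<Longrightarrow> t \<le> int N \<Longrightarrow> random_variable borel (\<sigma> N t)"
    and X_eq: "\<And>N t. 1 \<le> N \<Longrightarrow> t \<le> int N \<Longrightarrow>
          AE \<omega> in M. X N t \<omega> = \<sigma> N t \<omega> * Z t \<omega>"
    and \<sigma>_eq: "\<And>N t. 1 \<le> N \<Longrightarrow> t \<le> int N \<Longrightarrow>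
          AE \<omega> in M. (\<sigma> N t \<omega>)\<^sup>2 =
            tv_coeff (a 0) N t + (\<Sum>j=1..p. tv_coeff (a j) N t * (X N (t - int j) \<omega>)\<^sup>2)"
    and X_causal: "\<And>N t. 1 \<le> N \<Longrightarrow> t \<le> int N \<Longrightarrow>
          \<exists>g \<in> borel_measurable (\<Pi>\<^sub>M k\<in>(UNIV :: nat set). (borel :: real measure)).
            AE \<omega> in M. X N t \<omega> = g (\<lambda>k. Z (t - int k) \<omega>)"
    and X_square_integrable: "\<And>N t. 1 \<le> N \<Longrightarrow> t \<le> int N \<Longrightarrow>
          integrable M (\<lambda>\<omega>. (X N t \<omega>)\<^sup>2)"
    and X_second_moment_bounded: "\<And>N. 1 \<le> N \<Longrightarrow>
          \<exists>C. \<forall>t \<le> int N. expectation (\<lambda>\<omega>. (X N t \<omega>)\<^sup>2) \<le> C"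

definition covariance :: "'a measure \<Rightarrow> ('a \<Rightarrow> real) \<Rightarrow> ('a \<Rightarrow> real) \<Rightarrow> real" where
  "covariance M f g =
    integral\<^sup>L M (\<lambda>\<omega>. (f \<omega> - integral\<^sup>L M f) * (g \<omega> - integral\<^sup>L M g))"

end

theory Submission
  imports Defs
begin

text \<open>
  Iterating the recursion for the squares \<open>n\<close> times from zero gives nonnegative lower bounds
  \<open>approx n t\<close> of \<open>X\<^sup>2\<close> at time \<open>t\<close> which involve only the last \<open>p * n\<close> innovations. Since the
  innovation at time \<open>t\<close> is independent of the past, one iteration contracts the error by
  \<open>1 - \<delta>\<close>, both in \<open>L\<^sup>1\<close> and in \<open>L\<^sup>2\<close>. The \<open>L\<^sup>2\<close> norms of the iterates are bounded, the
  \<open>L\<^sup>1\<close> contraction (available from the second moments alone) identifies their limit with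
  \<open>X\<^sup>2\<close>, and Fatou's lemma yields a uniform bound on the fourth moments of \<open>X\<close>. With
  \<open>n = h div p\<close> the iterate at time \<open>t + h\<close> is independent of \<open>X\<close> at time \<open>t\<close>, so that only the
  error, of size \<open>(1 - \<delta>) ^ n\<close>, contributes to the covariance.
\<close>

section \<open>Random variables determined by a set of innovations\<close>

text \<open>Equality is required only almost surely, matching the form of the model identities.
  Hence \<open>f\<close> itself need not be measurable, and lemmas that integrate it assume
  integrability separately.\<close>

definition (in prob_space) depends_on :: "('i \<Rightarrow> 'a \<Rightarrow> real) \<Rightarrow> 'i set \<Rightarrow> ('a \<Rightarrow> real) \<Rightarrow> bool" where
  "depends_on Z A f \<longleftrightarrow>
    (\<exists>g\<in>borel_measurable (PiM A (\<lambda>_. borel)). AE \<omega> in M. f \<omega> = g (\<lambda>i\<in>A. Z i \<omega>))"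

context prob_space
begin

lemma depends_on_const: "depends_on Z A (\<lambda>_. c)"
  unfolding depends_on_def by (rule bexI[of _ "\<lambda>_. c"]) auto

lemma depends_on_component: "i \<in> A \<Longrightarrow> depends_on Z A (Z i)"
  unfolding depends_on_def
  by (rule bexI[of _ "\<lambda>x. x i"]) (auto intro: measurable_component_singleton)

lemma depends_on_subset:
  assumes "depends_on Z A f" "A \<subseteq> B"
  shows "depends_on Z B f"
proof -
  obtain g where g: "g \<in> borel_measurable (PiM A (\<lambda>_. borel))"
    "AE \<omega> in M. f \<omega> = g (\<lambda>i\<in>A. Z i \<omega>)"
    using assms unfolding depends_on_def by blast
  have "(\<lambda>x. g (restrict x A)) \<in> borel_measurable (PiM B (\<lambda>_. borel))"
    by (rule measurable_compose[OF measurable_restrict_subset[OF assms(2)] g(1)])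
  moreover have "restrict (\<lambda>i\<in>B. Z i \<omega>) A = (\<lambda>i\<in>A. Z i \<omega>)" for \<omega>
    using assms(2) by (auto simp: restrict_def fun_eq_iff)
  then have "AE \<omega> in M. f \<omega> = g (restrict (\<lambda>i\<in>B. Z i \<omega>) A)"
    using g(2) by simp
  ultimately show ?thesis
    unfolding depends_on_def by (intro bexI[of _ "\<lambda>x. g (restrict x A)"])
qed

lemma depends_on_map2:
  assumes "depends_on Z A f1" "depends_on Z A f2"
    and h: "(\<lambda>(x, y). h x y) \<in> borel_measurable (borel \<Otimes>\<^sub>M borel)"
  shows "depends_on Z A (\<lambda>\<omega>. h (f1 \<omega>) (f2 \<omega>))"
proof -
  obtain g1 g2 where [measurable]: "g1 \<in> borel_measurable (PiM A (\<lambda>_. borel))"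
    "g2 \<in> borel_measurable (PiM A (\<lambda>_. borel))"
    and ae: "AE \<omega> in M. f1 \<omega> = g1 (\<lambda>i\<in>A. Z i \<omega>)" "AE \<omega> in M. f2 \<omega> = g2 (\<lambda>i\<in>A. Z i \<omega>)"
    using assms(1,2) unfolding depends_on_def by blast
  have "(\<lambda>x. (\<lambda>(x, y). h x y) (g1 x, g2 x)) \<in> borel_measurable (PiM A (\<lambda>_. borel))"
    by (rule measurable_compose[OF _ h]) measurable
  then have "(\<lambda>x. h (g1 x) (g2 x)) \<in> borel_measurable (PiM A (\<lambda>_. borel))"
    by simp
  moreover have "AE \<omega> in M. h (f1 \<omega>) (f2 \<omega>) = h (g1 (\<lambda>i\<in>A. Z i \<omega>)) (g2 (\<lambda>i\<in>A. Z i \<omega>))"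
    using ae by eventually_elim simp
  ultimately show ?thesis
    unfolding depends_on_def by (intro bexI[of _ "\<lambda>x. h (g1 x) (g2 x)"])
qed

lemma depends_on_add:
  "depends_on Z A f \<Longrightarrow> depends_on Z A g \<Longrightarrow> depends_on Z A (\<lambda>\<omega>. f \<omega> + g \<omega>)"
  by (rule depends_on_map2[where h = "(+)"]) (auto simp: split_def)

lemma depends_on_diff:
  "depends_on Z A f \<Longrightarrow> depends_on Z A g \<Longrightarrow> depends_on Z A (\<lambda>\<omega>. f \<omega> - g \<omega>)"
  by (rule depends_on_map2[where h = "(-)"]) (auto simp: split_def)

lemma depends_on_mult:
  "depends_on Z A f \<Longrightarrow> depends_on Z A g \<Longrightarrow> depends_on Z A (\<lambda>\<omega>. f \<omega> * g \<omega>)"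
  by (rule depends_on_map2[where h = "(*)"]) (auto simp: split_def)

lemma depends_on_power2: "depends_on Z A f \<Longrightarrow> depends_on Z A (\<lambda>\<omega>. (f \<omega>)\<^sup>2)"
  unfolding power2_eq_square by (rule depends_on_mult)

lemma depends_on_sum:
  "(\<And>j. j \<in> J \<Longrightarrow> depends_on Z A (f j)) \<Longrightarrow> depends_on Z A (\<lambda>\<omega>. \<Sum>j\<in>J. f j \<omega>)"
  by (induction J rule: infinite_finite_induct) (auto intro: depends_on_const depends_on_add)

text \<open>Restrictions of an independent family to disjoint index sets are independent, hence so
  are \<open>f'\<close> and \<open>g'\<close> composed with them. Almost sure equality carries
  integrability and expectations over to \<open>f\<close> and \<open>g\<close>.\<close>

lemma depends_on_disjoint_mult:
  assumes ind: "indep_vars (\<lambda>_. borel) Z UNIV"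
    and dep: "depends_on Z A f" "depends_on Z B g" and "A \<inter> B = {}"
    and f: "integrable M f" and g: "integrable M g"
  shows "integrable M (\<lambda>\<omega>. f \<omega> * g \<omega>)"
    and "expectation (\<lambda>\<omega>. f \<omega> * g \<omega>) = expectation f * expectation g"
proof -
  let ?r = "\<lambda>A \<omega>. restrict (\<lambda>i. Z i \<omega>) A"
  obtain f' where f': "f' \<in> borel_measurable (PiM A (\<lambda>_. borel))" "AE \<omega> in M. f \<omega> = f' (?r A \<omega>)"
    using dep(1) unfolding depends_on_def by blast
  obtain g' where g': "g' \<in> borel_measurable (PiM B (\<lambda>_. borel))" "AE \<omega> in M. g \<omega> = g' (?r B \<omega>)"
    using dep(2) unfolding depends_on_def by blast
  have Z[measurable]: "random_variable borel (Z i)" for i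
    using ind by (auto simp: indep_vars_def)
  have r[measurable]: "?r C \<in> measurable M (PiM C (\<lambda>_. borel))" for C
    by (rule measurable_restrict) simp
  have iv: "indep_var borel (f' \<circ> ?r A) borel (g' \<circ> ?r B)"
    by (rule indep_var_compose[OF indep_var_restrict[OF ind \<open>A \<inter> B = {}\<close>] f'(1) g'(1)]) auto
  have mf[measurable]: "f' \<circ> ?r A \<in> borel_measurable M" "g' \<circ> ?r B \<in> borel_measurable M"
    using measurable_comp[OF r f'(1)] measurable_comp[OF r g'(1)] by auto
  have [measurable]: "f \<in> borel_measurable M" "g \<in> borel_measurable M"
    using f g by auto
  have if': "integrable M (f' \<circ> ?r A)"
    using f f'(2) integrable_cong_AE[of f M "f' \<circ> ?r A"] by simp
  have ig': "integrable M (g' \<circ> ?r B)"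
    using g g'(2) integrable_cong_AE[of g M "g' \<circ> ?r B"] by simp
  have ae: "AE \<omega> in M. f \<omega> * g \<omega> = (f' \<circ> ?r A) \<omega> * (g' \<circ> ?r B) \<omega>"
    using f'(2) g'(2) by eventually_elim simp
  show "integrable M (\<lambda>\<omega>. f \<omega> * g \<omega>)"
    using indep_var_integrable[OF iv if' ig'] ae
    by (subst integrable_cong_AE[OF _ _ ae]) auto
  have "expectation (\<lambda>\<omega>. f \<omega> * g \<omega>) = expectation (\<lambda>\<omega>. (f' \<circ> ?r A) \<omega> * (g' \<circ> ?r B) \<omega>)"
    by (rule integral_cong_AE[OF _ _ ae]) measurable
  also have "\<dots> = expectation (f' \<circ> ?r A) * expectation (g' \<circ> ?r B)"
    by (rule indep_var_lebesgue_integral[OF iv if' ig'])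
  also have "expectation (f' \<circ> ?r A) = expectation f"
    using f'(2) by (intro integral_cong_AE) auto
  also have "expectation (g' \<circ> ?r B) = expectation g"
    using g'(2) by (intro integral_cong_AE) auto
  finally show "expectation (\<lambda>\<omega>. f \<omega> * g \<omega>) = expectation f * expectation g" .
qed

end

section \<open>Limits, products and covariance of integrable functions\<close>

text \<open>Fatou's lemma, giving integrability together with a bound: finiteness of the fourth
  moments of \<open>X\<close> is derived this way, not assumed.\<close>

lemma integrable_AE_limit_bounded:
  fixes f :: "'a \<Rightarrow> real"
  assumes u: "\<And>n. integrable M (u n)" "\<And>n x. 0 \<le> u n x" "\<And>n. integral\<^sup>L M (u n) \<le> C"
    and f[measurable]: "f \<in> borel_measurable M"
    and lim: "AE x in M. (\<lambda>n. u n x) \<longlonglongrightarrow> f x"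
  shows "integrable M f" and "integral\<^sup>L M f \<le> C"
proof -
  have [measurable]: "u n \<in> borel_measurable M" for n using u(1) by auto
  have nonneg: "AE x in M. 0 \<le> f x"
    using lim by eventually_elim (auto intro: LIMSEQ_le_const u(2))
  \<comment> \<open>Nonnegativity of \<open>C\<close> matters when returning to real integrals,
    because \<open>ennreal\<close> sends negative numbers to 0.\<close>
  have "0 \<le> integral\<^sup>L M (u 0)" using u(2) by simp
  then have C: "0 \<le> C" using u(3)[of 0] by linarith
  have "(\<integral>\<^sup>+x. ennreal (f x) \<partial>M) = (\<integral>\<^sup>+x. liminf (\<lambda>n. ennreal (u n x)) \<partial>M)"
  proof (rule nn_integral_cong_AE)
    show "AE x in M. ennreal (f x) = liminf (\<lambda>n. ennreal (u n x))"
      using lim by eventually_elim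
        (metis lim_imp_Liminf sequentially_bot tendsto_ennrealI)
  qed
  also have "\<dots> \<le> liminf (\<lambda>n. \<integral>\<^sup>+x. ennreal (u n x) \<partial>M)"
    by (rule nn_integral_liminf) simp
  also have "\<dots> \<le> liminf (\<lambda>n::nat. ennreal C)"
    using u by (intro Liminf_mono) (simp add: nn_integral_eq_integral ennreal_leI)
  also have "\<dots> = ennreal C" by (simp add: Liminf_const)
  finally have le: "(\<integral>\<^sup>+x. ennreal (f x) \<partial>M) \<le> ennreal C" .
  show i: "integrable M f"
    using le by (intro integrableI_nonneg[OF f nonneg]) (auto simp: top_unique less_top[symmetric] dest: order_trans)
  show "integral\<^sup>L M f \<le> C"
    using le C nn_integral_eq_integral[OF i nonneg] by simp
qed

lemma integrable_mult_of_squares: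
  fixes f g :: "'a \<Rightarrow> real"
  assumes [measurable]: "f \<in> borel_measurable M" "g \<in> borel_measurable M"
    and "integrable M (\<lambda>x. (f x)\<^sup>2)" "integrable M (\<lambda>x. (g x)\<^sup>2)"
  shows "integrable M (\<lambda>x. f x * g x)"
proof (rule Bochner_Integration.integrable_bound[of M "\<lambda>x. (f x)\<^sup>2 + (g x)\<^sup>2", OF _ _ AE_I2])
  show "norm (f x * g x) \<le> norm ((f x)\<^sup>2 + (g x)\<^sup>2)" for x
  proof -
    have "2 * \<bar>f x * g x\<bar> \<le> (f x)\<^sup>2 + (g x)\<^sup>2"
      using sum_squares_bound[of "\<bar>f x\<bar>" "\<bar>g x\<bar>"] by (simp add: abs_mult)
    then show ?thesis by simp
  qed
qed (use assms in auto)

lemma (in prob_space) covariance_eq: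
  assumes "integrable M f" "integrable M g" "integrable M (\<lambda>\<omega>. f \<omega> * g \<omega>)"
  shows "covariance M f g = expectation (\<lambda>\<omega>. f \<omega> * g \<omega>) - expectation f * expectation g"
  unfolding covariance_def using assms by (simp add: algebra_simps prob_space)

section \<open>The squared recursion along one row\<close>

text \<open>
  One row of the array: \<open>b j t\<close> are the coefficients, \<open>Y t\<close> the squared observations, \<open>T\<close> the
  row length and \<open>\<kappa>\<close> the fourth moment of the innovations.
\<close>

locale squared_arch_row = prob_space M
  for M :: "'a measure" and Z :: "int \<Rightarrow> 'a \<Rightarrow> real" and p :: nat and T :: int
    and b :: "nat \<Rightarrow> int \<Rightarrow> real" and Y :: "int \<Rightarrow> 'a \<Rightarrow> real" and \<rho>2 S \<theta> \<kappa> :: real +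
  assumes p_pos: "1 \<le> p"
    and indep: "indep_vars (\<lambda>_. borel) Z UNIV"
    and Z2_int: "\<And>t. integrable M (\<lambda>\<omega>. (Z t \<omega>)\<^sup>2)"
    and Z2_exp: "\<And>t. expectation (\<lambda>\<omega>. (Z t \<omega>)\<^sup>2) = 1"
    and Z4_int: "\<And>t. integrable M (\<lambda>\<omega>. Z t \<omega> ^ 4)"
    and Z4_exp: "\<And>t. expectation (\<lambda>\<omega>. Z t \<omega> ^ 4) = \<kappa>"
    and theta: "0 < \<theta>" "\<theta> < 1" and S_nonneg: "0 \<le> S" and kappa_S: "\<kappa> * S\<^sup>2 \<le> \<theta>\<^sup>2"
    and b_nonneg: "\<And>j t. j \<le> p \<Longrightarrow> t \<le> T \<Longrightarrow> 0 \<le> b j t"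
    and b_0: "\<And>t. t \<le> T \<Longrightarrow> b 0 t \<le> \<rho>2"
    and b_sum: "\<And>t. t \<le> T \<Longrightarrow> (\<Sum>j=1..p. b j t) \<le> S"
    and Y_nonneg: "\<And>t \<omega>. 0 \<le> Y t \<omega>"
    and Y_int: "\<And>t. t \<le> T \<Longrightarrow> integrable M (Y t)"
    and Y_eq: "\<And>t. t \<le> T \<Longrightarrow>
      AE \<omega> in M. Y t \<omega> = (Z t \<omega>)\<^sup>2 * (b 0 t + (\<Sum>j=1..p. b j t * Y (t - int j) \<omega>))"
    and Y_dep: "\<And>t. t \<le> T \<Longrightarrow> depends_on Z {..t} (Y t)"
    and Y_bdd: "\<exists>C. \<forall>t\<le>T. expectation (Y t) \<le> C"
begin

primrec approx :: "nat \<Rightarrow> int \<Rightarrow> 'a \<Rightarrow> real" where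
  "approx 0 = (\<lambda>t \<omega>. 0)"
| "approx (Suc n) =
    (\<lambda>t \<omega>. (Z t \<omega>)\<^sup>2 * (b 0 t + (\<Sum>j=1..p. b j t * approx n (t - int j) \<omega>)))"

lemma Z_measurable[measurable]: "random_variable borel (Z t)"
  using indep by (auto simp: indep_vars_def)

lemma approx_measurable[measurable]: "approx n t \<in> borel_measurable M"
  by (induction n arbitrary: t) auto

lemma Y_measurable[measurable]: "t \<le> T \<Longrightarrow> Y t \<in> borel_measurable M"
  using Y_int by auto

lemma Z2_squared_int: "integrable M (\<lambda>\<omega>. ((Z t \<omega>)\<^sup>2)\<^sup>2)"
  using Z4_int by simp

text \<open>The variance of the squared innovation equals \<open>\<kappa> - 1\<close> and cannot be
  negative.\<close>

lemma kappa_ge_1: "1 \<le> \<kappa>"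
proof -
  have "variance (\<lambda>\<omega>. (Z 0 \<omega>)\<^sup>2) = \<kappa> - 1"
    by (subst variance_eq[OF Z2_int Z2_squared_int]) (simp add: Z2_exp Z4_exp)
  then show ?thesis
    using variance_positive[of "\<lambda>\<omega>. (Z 0 \<omega>)\<^sup>2"] by linarith
qed

text \<open>Lets first moments contract at the same rate \<open>\<theta>\<close> as the L2
  norm.\<close>

lemma S_le_theta: "S \<le> \<theta>"
proof -
  have "S\<^sup>2 \<le> \<kappa> * S\<^sup>2" using kappa_ge_1 by (simp add: mult_le_cancel_right1)
  then show ?thesis using kappa_S theta by (intro power2_le_imp_le[of S \<theta>]) auto
qed

lemma approx_nonneg: "t \<le> T \<Longrightarrow> 0 \<le> approx n t \<omega>"
  by (induction n arbitrary: t) (auto intro!: mult_nonneg_nonneg add_nonneg_nonneg sum_nonneg b_nonneg)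

text \<open>Each iteration reaches back at most \<open>p\<close> further lags. The window is open on
  the left so that it misses \<open>{..s}\<close> as soon as \<open>s \<le> t - int (p * n)\<close>;
  it is empty for \<open>n = 0\<close>, where the iterate is constant.\<close>

lemma approx_depends_on: "depends_on Z {t - int (p * n)<..t} (approx n t)"
proof (induction n arbitrary: t)
  case (Suc n)
  have "depends_on Z {t - int (p * Suc n)<..t} (approx n (t - int j))" if "j \<in> {1..p}" for j
    using that by (intro depends_on_subset[OF Suc]) auto
  moreover have "depends_on Z {t - int (p * Suc n)<..t} (Z t)"
    \<comment> \<open>Positivity of \<open>p\<close> ensures that the window contains
      \<open>t\<close>.\<close>
    using p_pos by (intro depends_on_component) (simp add: add_pos_nonneg algebra_simps)
  ultimately show ?case
    by (auto intro!: depends_on_mult depends_on_power2 depends_on_add depends_on_sum depends_on_const)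
qed (simp add: depends_on_const)

lemma approx_depends_on_past: "depends_on Z {..t} (approx n t)"
  by (rule depends_on_subset[OF approx_depends_on]) auto

section \<open>Contraction of moments in one step of the recursion\<close>

lemma innovation_depends_on: "depends_on Z {t} (\<lambda>\<omega>. (Z t \<omega>)\<^sup>2)"
  by (intro depends_on_power2 depends_on_component) simp

text \<open>Lags start at 1, so the weighted past omits time \<open>t\<close>; this later gives
  independence from the innovation at \<open>t\<close>.\<close>

lemma weighted_past_depends_on:
  assumes "\<And>j. j \<in> {1..p} \<Longrightarrow> depends_on Z {..t - int j} (D j)"
  shows "depends_on Z {..<t} (\<lambda>\<omega>. \<Sum>j=1..p. b j t * D j \<omega>)"
  by (intro depends_on_sum depends_on_mult depends_on_const depends_on_subset[OF assms]) auto

lemma sum_weights_le: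
  assumes "t \<le> T" "0 \<le> B" "\<And>j. j \<in> {1..p} \<Longrightarrow> e j \<le> B"
  shows "(\<Sum>j=1..p. b j t * e j) \<le> S * B"
proof -
  have "(\<Sum>j=1..p. b j t * e j) \<le> (\<Sum>j=1..p. b j t * B)"
    using assms by (intro sum_mono mult_left_mono b_nonneg) auto
  also have "\<dots> = (\<Sum>j=1..p. b j t) * B" by (simp add: sum_distrib_right)
  also have "\<dots> \<le> S * B" using assms by (intro mult_right_mono b_sum) auto
  finally show ?thesis .
qed

text \<open>The innovation is independent of the weighted past and its square has mean 1, so only
  the total weight, at most \<open>S\<close>, remains as a factor.\<close>

lemma step_first_moment:
  assumes t: "t \<le> T" and "0 \<le> B"
    and D: "\<And>j. j \<in> {1..p} \<Longrightarrow> integrable M (D j)"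
      "\<And>j. j \<in> {1..p} \<Longrightarrow> depends_on Z {..t - int j} (D j)"
      "\<And>j. j \<in> {1..p} \<Longrightarrow> expectation (D j) \<le> B"
  shows "integrable M (\<lambda>\<omega>. (Z t \<omega>)\<^sup>2 * (\<Sum>j=1..p. b j t * D j \<omega>))"
    and "expectation (\<lambda>\<omega>. (Z t \<omega>)\<^sup>2 * (\<Sum>j=1..p. b j t * D j \<omega>)) \<le> S * B"
proof -
  let ?s = "\<lambda>\<omega>. \<Sum>j=1..p. b j t * D j \<omega>"
  have s: "integrable M ?s" using D by auto
  have disj: "{t} \<inter> {..<t} = {}" by auto
  note ind = depends_on_disjoint_mult[OF indep innovation_depends_on
      weighted_past_depends_on[OF D(2)] disj Z2_int s]
  show "integrable M (\<lambda>\<omega>. (Z t \<omega>)\<^sup>2 * ?s \<omega>)" by (rule ind)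
  have "expectation (\<lambda>\<omega>. (Z t \<omega>)\<^sup>2 * ?s \<omega>) = (\<Sum>j=1..p. b j t * expectation (D j))"
    using ind(2) D by (simp add: Z2_exp Bochner_Integration.integral_sum)
  also have "\<dots> \<le> S * B" by (rule sum_weights_le[OF t \<open>0 \<le> B\<close> D(3)])
  finally show "expectation (\<lambda>\<omega>. (Z t \<omega>)\<^sup>2 * ?s \<omega>) \<le> S * B" .
qed

text \<open>Weighted Cauchy-Schwarz bounds the squared sum by \<open>S\<close> times the weighted
  sum of squares, whose mean is at most \<open>S * B\<close>. The independent innovation contributes
  the factor \<open>\<kappa>\<close>, and
  \<open>\<kappa> * S\<^sup>2 \<le> \<theta>\<^sup>2\<close>.\<close>

lemma step_second_moment:
  assumes t: "t \<le> T" and "0 \<le> B"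
    and D: "\<And>j. j \<in> {1..p} \<Longrightarrow> D j \<in> borel_measurable M"
      "\<And>j. j \<in> {1..p} \<Longrightarrow> integrable M (\<lambda>\<omega>. (D j \<omega>)\<^sup>2)"
      "\<And>j. j \<in> {1..p} \<Longrightarrow> depends_on Z {..t - int j} (D j)"
      "\<And>j. j \<in> {1..p} \<Longrightarrow> expectation (\<lambda>\<omega>. (D j \<omega>)\<^sup>2) \<le> B"
  shows "integrable M (\<lambda>\<omega>. ((Z t \<omega>)\<^sup>2 * (\<Sum>j=1..p. b j t * D j \<omega>))\<^sup>2)"
    and "expectation (\<lambda>\<omega>. ((Z t \<omega>)\<^sup>2 * (\<Sum>j=1..p. b j t * D j \<omega>))\<^sup>2) \<le> \<theta>\<^sup>2 * B"
proof -
  let ?s = "\<lambda>\<omega>. \<Sum>j=1..p. b j t * D j \<omega>"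
  let ?q = "\<lambda>\<omega>. S * (\<Sum>j=1..p. b j t * (D j \<omega>)\<^sup>2)"
  have [measurable]: "?s \<in> borel_measurable M" using D(1) by auto
  have q: "integrable M ?q" using D(2) by auto
  have le: "(?s \<omega>)\<^sup>2 \<le> ?q \<omega>" for \<omega>
  proof -
    \<comment> \<open>Writing each weight as a product of two square roots brings the sum into the
      form of Cauchy-Schwarz.\<close>
    have "(?s \<omega>)\<^sup>2 = (\<Sum>j=1..p. sqrt (b j t) * (sqrt (b j t) * D j \<omega>))\<^sup>2"
      using b_nonneg[OF _ t] by (intro arg_cong[where f = "\<lambda>x. x\<^sup>2"] sum.cong) auto
    also have "\<dots> \<le> (\<Sum>j=1..p. (sqrt (b j t))\<^sup>2) * (\<Sum>j=1..p. (sqrt (b j t) * D j \<omega>)\<^sup>2)"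
      by (rule Cauchy_Schwarz_ineq_sum)
    also have "\<dots> = (\<Sum>j=1..p. b j t) * (\<Sum>j=1..p. b j t * (D j \<omega>)\<^sup>2)"
      using b_nonneg[OF _ t] by (simp add: power_mult_distrib)
    also have "\<dots> \<le> ?q \<omega>"
      using b_nonneg[OF _ t] by (intro mult_right_mono b_sum[OF t] sum_nonneg) auto
    finally show ?thesis .
  qed
  have s2: "integrable M (\<lambda>\<omega>. (?s \<omega>)\<^sup>2)"
  proof (rule Bochner_Integration.integrable_bound[OF q _ AE_I2])
    show "norm ((?s \<omega>)\<^sup>2) \<le> norm (?q \<omega>)" for \<omega>
      using order_trans[OF le abs_ge_self, of \<omega>] by simp
  qed measurable
  have disj: "{t} \<inter> {..<t} = {}" by auto
  note ind = depends_on_disjoint_mult[OF indep depends_on_power2[OF innovation_depends_on]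
      depends_on_power2[OF weighted_past_depends_on[OF D(3)]] disj Z2_squared_int s2]
  show "integrable M (\<lambda>\<omega>. ((Z t \<omega>)\<^sup>2 * ?s \<omega>)\<^sup>2)"
    using ind(1) by (simp add: power_mult_distrib)
  have "expectation (\<lambda>\<omega>. ((Z t \<omega>)\<^sup>2 * ?s \<omega>)\<^sup>2) = \<kappa> * expectation (\<lambda>\<omega>. (?s \<omega>)\<^sup>2)"
    using ind(2) by (simp add: power_mult_distrib Z4_exp)
  also have "expectation (\<lambda>\<omega>. (?s \<omega>)\<^sup>2) \<le> expectation ?q"
    by (rule integral_mono[OF s2 q le])
  also have "expectation ?q = S * (\<Sum>j=1..p. b j t * expectation (\<lambda>\<omega>. (D j \<omega>)\<^sup>2))"
    using D(2) by (simp add: Bochner_Integration.integral_sum)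
  also have "\<dots> \<le> S * (S * B)"
    by (intro mult_left_mono sum_weights_le t D(4) \<open>0 \<le> B\<close> S_nonneg)
  finally have "expectation (\<lambda>\<omega>. ((Z t \<omega>)\<^sup>2 * ?s \<omega>)\<^sup>2) \<le> \<kappa> * (S * (S * B))"
    using kappa_ge_1 by auto
  also have "\<dots> = (\<kappa> * S\<^sup>2) * B" by (simp add: power2_eq_square)
  also have "\<dots> \<le> \<theta>\<^sup>2 * B" by (rule mult_right_mono[OF kappa_S \<open>0 \<le> B\<close>])
  finally show "expectation (\<lambda>\<omega>. ((Z t \<omega>)\<^sup>2 * ?s \<omega>)\<^sup>2) \<le> \<theta>\<^sup>2 * B" .
qed

section \<open>Uniform second moments of the iterates\<close>

text \<open>The fixed point \<open>m\<close> of \<open>m = (1 + 1 / (1 - \<theta>)) *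
  (\<rho>2\<^sup>2 * \<kappa>) + \<theta> * m\<close>, the recursive bound that the second moments
  of the iterates satisfy.\<close>

definition moment_bound :: real where
  "moment_bound = \<kappa> * (1 + 1 / (1 - \<theta>)) * \<rho>2\<^sup>2 / (1 - \<theta>)"

lemma moment_bound_nonneg: "0 \<le> moment_bound"
  using theta kappa_ge_1 by (auto simp: moment_bound_def)

text \<open>Young's inequality with weight \<open>1 - \<theta>\<close> separates the intercept from
  the contracted part. This weight is small enough for the contraction to survive with factor
  \<open>\<theta>\<close> in place of \<open>\<theta>\<^sup>2\<close>, so that
  \<open>moment_bound\<close> reproduces itself.\<close>

lemma approx_second_moment:
  assumes "t \<le> T"
  shows "integrable M (\<lambda>\<omega>. (approx n t \<omega>)\<^sup>2) \<and>
    expectation (\<lambda>\<omega>. (approx n t \<omega>)\<^sup>2) \<le> moment_bound"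
  using assms
proof (induction n arbitrary: t)
  case 0
  then show ?case by (simp add: moment_bound_nonneg)
next
  case (Suc n)
  let ?\<epsilon> = "1 - \<theta>"
  let ?D = "\<lambda>j. approx n (t - int j)"
  let ?s = "\<lambda>\<omega>. (Z t \<omega>)\<^sup>2 * (\<Sum>j=1..p. b j t * ?D j \<omega>)"
  have IH: "integrable M (\<lambda>\<omega>. (?D j \<omega>)\<^sup>2)" "expectation (\<lambda>\<omega>. (?D j \<omega>)\<^sup>2) \<le> moment_bound" for j
    using Suc.IH[of "t - int j"] Suc.prems by auto
  note st = step_second_moment[where D = ?D, OF Suc.prems moment_bound_nonneg approx_measurable IH(1)
      approx_depends_on_past IH(2)]
  let ?u = "\<lambda>\<omega>. (1 + 1 / ?\<epsilon>) * ((b 0 t)\<^sup>2 * ((Z t \<omega>)\<^sup>2)\<^sup>2) + (1 + ?\<epsilon>) * (?s \<omega>)\<^sup>2"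
  have u: "integrable M ?u" using st(1) Z4_int by auto
  have young: "(x + y)\<^sup>2 \<le> (1 + 1 / ?\<epsilon>) * x\<^sup>2 + (1 + ?\<epsilon>) * y\<^sup>2" for x y :: real
  proof -
    have "0 \<le> (x - ?\<epsilon> * y)\<^sup>2 / ?\<epsilon>" using theta by auto
    also have "\<dots> = x\<^sup>2 / ?\<epsilon> - 2 * x * y + ?\<epsilon> * y\<^sup>2"
      using theta by (simp add: field_simps power2_eq_square)
    finally show ?thesis by (simp add: power2_sum algebra_simps)
  qed
  have le: "(approx (Suc n) t \<omega>)\<^sup>2 \<le> ?u \<omega>" for \<omega>
    using young[of "(Z t \<omega>)\<^sup>2 * b 0 t" "?s \<omega>"]
    by (simp add: algebra_simps power_mult_distrib)
  have i: "integrable M (\<lambda>\<omega>. (approx (Suc n) t \<omega>)\<^sup>2)"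
    by (rule Bochner_Integration.integrable_bound[OF u])
      (use le in \<open>auto intro!: AE_I2 order_trans[OF _ abs_ge_self] simp del: approx.simps\<close>)
  have "expectation (\<lambda>\<omega>. (approx (Suc n) t \<omega>)\<^sup>2) \<le> expectation ?u"
    by (rule integral_mono[OF i u le])
  also have "\<dots> = (1 + 1 / ?\<epsilon>) * ((b 0 t)\<^sup>2 * \<kappa>) + (1 + ?\<epsilon>) * expectation (\<lambda>\<omega>. (?s \<omega>)\<^sup>2)"
    using st(1) Z4_int by (simp add: Z4_exp)
  also have "\<dots> \<le> (1 + 1 / ?\<epsilon>) * (\<rho>2\<^sup>2 * \<kappa>) + (1 + ?\<epsilon>) * (\<theta>\<^sup>2 * moment_bound)"
    using st(2) theta kappa_ge_1 b_0[OF Suc.prems] b_nonneg[of 0, OF _ Suc.prems]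
    by (intro add_mono mult_left_mono mult_right_mono power_mono) auto
  also have "\<dots> \<le> (1 + 1 / ?\<epsilon>) * (\<rho>2\<^sup>2 * \<kappa>) + \<theta> * moment_bound"
  proof -
    \<comment> \<open>Expanding the product gives
      \<open>(2 - \<theta>) * \<theta>\<^sup>2 \<le> \<theta>\<close>.\<close>
    have "0 \<le> \<theta> * (1 - \<theta>)\<^sup>2" using theta by simp
    then have "(1 + ?\<epsilon>) * \<theta>\<^sup>2 \<le> \<theta>" by (simp add: power2_eq_square algebra_simps)
    from mult_right_mono[OF this moment_bound_nonneg] show ?thesis by (simp add: mult.assoc)
  qed
  also have "\<dots> = moment_bound"
    using theta by (simp add: moment_bound_def divide_simps) (simp add: algebra_simps)
  finally show ?case using i by simp
qed

section \<open>Residuals and the second moment of the squared process\<close>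

text \<open>The recursion is monotone because weights and squares are nonnegative, and it starts
  from 0. The residual is therefore nonnegative, and its expectation is its L1 norm.\<close>

lemma approx_le: "t \<le> T \<Longrightarrow> AE \<omega> in M. approx n t \<omega> \<le> Y t \<omega>"
proof (induction n arbitrary: t)
  case (Suc n)
  have "AE \<omega> in M. \<forall>j\<in>{1..p}. approx n (t - int j) \<omega> \<le> Y (t - int j) \<omega>"
    using Suc by (intro AE_finite_allI) auto
  then show ?case
    using Y_eq[OF Suc.prems]
  proof eventually_elim
    case (elim \<omega>)
    show ?case unfolding elim(2) approx.simps
      using elim(1) Suc.prems
      by (intro mult_left_mono add_left_mono sum_mono b_nonneg) auto
  qed
qed (simp add: Y_nonneg)

text \<open>The intercept cancels, so residuals obey the homogeneous recursion to which the two
  contraction lemmas apply.\<close>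

lemma residual_step:
  assumes "t \<le> T"
  shows "AE \<omega> in M. Y t \<omega> - approx (Suc n) t \<omega> =
    (Z t \<omega>)\<^sup>2 * (\<Sum>j=1..p. b j t * (Y (t - int j) \<omega> - approx n (t - int j) \<omega>))"
  using Y_eq[OF assms]
  by eventually_elim (simp add: algebra_simps sum_subtractf)

lemma residual_depends_on: "t \<le> T \<Longrightarrow> depends_on Z {..t} (\<lambda>\<omega>. Y t \<omega> - approx n t \<omega>)"
  by (intro depends_on_diff Y_dep approx_depends_on_past)

text \<open>The constant \<open>C\<close> is left free because it is instantiated twice: first with
  the row-dependent bound on \<open>expectation (Y t)\<close>, later with
  \<open>sqrt moment_bound\<close>, once second moments are known.\<close>

lemma residual_first_moment:
  assumes "0 \<le> C" "\<And>t. t \<le> T \<Longrightarrow> expectation (Y t) \<le> C" "t \<le> T"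
  shows "integrable M (\<lambda>\<omega>. Y t \<omega> - approx n t \<omega>) \<and>
    expectation (\<lambda>\<omega>. Y t \<omega> - approx n t \<omega>) \<le> \<theta> ^ n * C"
  using assms(3)
proof (induction n arbitrary: t)
  case 0
  then show ?case using assms(2) Y_int by simp
next
  case (Suc n)
  let ?D = "\<lambda>j \<omega>. Y (t - int j) \<omega> - approx n (t - int j) \<omega>"
  have B: "0 \<le> \<theta> ^ n * C" using assms theta by auto
  have IH: "integrable M (?D j)" "expectation (?D j) \<le> \<theta> ^ n * C" for j
    using Suc.IH[of "t - int j"] Suc.prems by auto
  have "depends_on Z {..t - int j} (?D j)" for j
    using Suc.prems by (intro residual_depends_on) auto
  note st = step_first_moment[where D = ?D, OF Suc.prems B IH(1) this IH(2)]
  have [measurable]: "Y t \<in> borel_measurable M" using Suc.prems by simp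
  note meas = borel_measurable_integrable[OF st(1)]
  have "integrable M (\<lambda>\<omega>. Y t \<omega> - approx (Suc n) t \<omega>)"
    by (subst integrable_cong_AE[OF _ meas residual_step[OF Suc.prems]]) (measurable, rule st(1))
  moreover have "expectation (\<lambda>\<omega>. Y t \<omega> - approx (Suc n) t \<omega>) \<le> S * (\<theta> ^ n * C)"
    by (subst integral_cong_AE[OF _ meas residual_step[OF Suc.prems]]) (measurable, rule st(2))
  moreover have "S * (\<theta> ^ n * C) \<le> \<theta> ^ Suc n * C"
    using mult_right_mono[OF S_le_theta B] by (simp add: mult.assoc)
  ultimately show ?case by linarith
qed

text \<open>L1 convergence of the iterates to \<open>Y t\<close> gives almost sure convergence along
  a subsequence, and Fatou's lemma transfers their bound. The row-dependent constant
  \<open>C\<close> only serves to show convergence and leaves no trace in the result.\<close>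

lemma Y_second_moment:
  assumes "t \<le> T"
  shows "integrable M (\<lambda>\<omega>. (Y t \<omega>)\<^sup>2)" and "expectation (\<lambda>\<omega>. (Y t \<omega>)\<^sup>2) \<le> moment_bound"
proof -
  obtain C where C: "\<And>t. t \<le> T \<Longrightarrow> expectation (Y t) \<le> C" using Y_bdd by auto
  have C0: "0 \<le> C" using C[OF assms] Bochner_Integration.integral_nonneg[of M "Y t"] Y_nonneg
    by (meson order_trans)
  let ?R = "\<lambda>n \<omega>. Y t \<omega> - approx n t \<omega>"
  note R = residual_first_moment[OF C0 C assms]
  have [measurable]: "Y t \<in> borel_measurable M" using assms by simp
  have R_norm: "expectation (\<lambda>\<omega>. norm (?R n \<omega>)) = expectation (?R n)" for n
    using approx_le[OF assms, of n] by (intro integral_cong_AE) (auto elim!: eventually_mono)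
  have "(\<lambda>n. expectation (\<lambda>\<omega>. norm (?R n \<omega>))) \<longlonglongrightarrow> 0"
  proof (rule Lim_null_comparison[OF always_eventually])
    have "0 \<le> expectation (\<lambda>\<omega>. norm (?R n \<omega>))" for n by simp
    then show "\<forall>n. norm (expectation (\<lambda>\<omega>. norm (?R n \<omega>))) \<le> \<theta> ^ n * C"
      using R unfolding R_norm by simp
    show "(\<lambda>n. \<theta> ^ n * C) \<longlonglongrightarrow> 0"
      using theta by (intro tendsto_mult_left_zero LIMSEQ_power_zero) auto
  qed
  then obtain r where r: "AE \<omega> in M. (\<lambda>n. ?R (r n) \<omega>) \<longlonglongrightarrow> 0"
    using tendsto_L1_AE_subseq[of M ?R] R by blast
  have "AE \<omega> in M. (\<lambda>n. (approx (r n) t \<omega>)\<^sup>2) \<longlonglongrightarrow> (Y t \<omega>)\<^sup>2"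
    using r
  proof eventually_elim
    case (elim \<omega>)
    have "(\<lambda>n. Y t \<omega> - ?R (r n) \<omega>) \<longlonglongrightarrow> Y t \<omega> - 0"
      by (intro tendsto_diff tendsto_const elim)
    then show ?case by (auto intro: tendsto_power)
  qed
  note lim = integrable_AE_limit_bounded[OF _ _ _ _ this, of moment_bound]
  show "integrable M (\<lambda>\<omega>. (Y t \<omega>)\<^sup>2)" "expectation (\<lambda>\<omega>. (Y t \<omega>)\<^sup>2) \<le> moment_bound"
    using approx_second_moment[OF assms] by (auto intro!: lim)
qed

text \<open>For \<open>n = 0\<close> the residual is \<open>Y t\<close> itself, whose square is
  integrable by now; each iteration then gains a factor \<open>\<theta>\<^sup>2\<close>.\<close>

lemma residual_second_moment:
  assumes "t \<le> T"
  shows "integrable M (\<lambda>\<omega>. (Y t \<omega> - approx n t \<omega>)\<^sup>2) \<and>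
    expectation (\<lambda>\<omega>. (Y t \<omega> - approx n t \<omega>)\<^sup>2) \<le> (\<theta> ^ n)\<^sup>2 * moment_bound"
  using assms
proof (induction n arbitrary: t)
  case 0
  then show ?case using Y_second_moment by simp
next
  case (Suc n)
  let ?D = "\<lambda>j \<omega>. Y (t - int j) \<omega> - approx n (t - int j) \<omega>"
  have B: "0 \<le> (\<theta> ^ n)\<^sup>2 * moment_bound" using moment_bound_nonneg by auto
  have IH: "integrable M (\<lambda>\<omega>. (?D j \<omega>)\<^sup>2)"
    "expectation (\<lambda>\<omega>. (?D j \<omega>)\<^sup>2) \<le> (\<theta> ^ n)\<^sup>2 * moment_bound" for j
    using Suc.IH[of "t - int j"] Suc.prems by auto
  have m: "?D j \<in> borel_measurable M" for j using Suc.prems by auto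
  have "depends_on Z {..t - int j} (?D j)" for j
    using Suc.prems by (intro residual_depends_on) auto
  note st = step_second_moment[where D = ?D, OF Suc.prems B m IH(1) this IH(2)]
  have [measurable]: "Y t \<in> borel_measurable M" using Suc.prems by simp
  note meas = borel_measurable_integrable[OF st(1)]
  have ae: "AE \<omega> in M. (Y t \<omega> - approx (Suc n) t \<omega>)\<^sup>2 =
      ((Z t \<omega>)\<^sup>2 * (\<Sum>j=1..p. b j t * ?D j \<omega>))\<^sup>2"
    using residual_step[OF Suc.prems, of n] by eventually_elim (simp only:)
  have "integrable M (\<lambda>\<omega>. (Y t \<omega> - approx (Suc n) t \<omega>)\<^sup>2)"
    by (subst integrable_cong_AE[OF _ meas ae]) (measurable, rule st(1))
  moreover have "expectation (\<lambda>\<omega>. (Y t \<omega> - approx (Suc n) t \<omega>)\<^sup>2) \<le>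
      \<theta>\<^sup>2 * ((\<theta> ^ n)\<^sup>2 * moment_bound)"
    by (subst integral_cong_AE[OF _ meas ae]) (measurable, rule st(2))
  ultimately show ?case by (simp add: power_mult_distrib mult.assoc)
qed

lemma Y_mult_Y_integrable:
  assumes "s \<le> T" "t \<le> T"
  shows "integrable M (\<lambda>\<omega>. Y s \<omega> * Y t \<omega>)"
  by (rule integrable_mult_of_squares)
    (use assms Y_second_moment in auto)

text \<open>Follows from nonnegativity of the variance, and replaces the row-dependent bound on
  first moments by a uniform one.\<close>

lemma Y_expectation_le:
  assumes "t \<le> T"
  shows "expectation (Y t) \<le> sqrt moment_bound"
proof (rule real_le_rsqrt)
  show "(expectation (Y t))\<^sup>2 \<le> moment_bound"
    using Y_second_moment[OF assms] variance_positive[of "Y t"]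
      variance_eq[OF Y_int[OF assms] Y_second_moment(1)[OF assms]]
    by linarith
qed

section \<open>Decay of the covariance within a row\<close>

text \<open>When \<open>Y t\<close> is split into iterate and residual, the iterate is independent
  of \<open>Y s\<close> and drops out. What remains is the mean of \<open>Y s\<close> times the
  residual minus the product of their means; both terms lie between 0 and the stated bound.\<close>

lemma abs_covariance_le:
  assumes s: "s \<le> T" and t: "t \<le> T" and far: "s \<le> t - int (p * n)"
  shows "\<bar>covariance M (Y s) (Y t)\<bar> \<le> \<theta> ^ n * moment_bound"
proof -
  let ?R = "\<lambda>\<omega>. Y t \<omega> - approx n t \<omega>"
  have [measurable]: "Y s \<in> borel_measurable M" "Y t \<in> borel_measurable M" using s t by auto
  have R1: "integrable M ?R" "expectation ?R \<le> \<theta> ^ n * sqrt moment_bound"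
    using residual_first_moment[of "sqrt moment_bound" t n] Y_expectation_le t moment_bound_nonneg
    by auto
  have R2: "integrable M (\<lambda>\<omega>. (?R \<omega>)\<^sup>2)"
    "expectation (\<lambda>\<omega>. (?R \<omega>)\<^sup>2) \<le> (\<theta> ^ n)\<^sup>2 * moment_bound"
    using residual_second_moment[OF t] by auto
  have R_nonneg: "AE \<omega> in M. 0 \<le> ?R \<omega>" using approx_le[OF t, of n] by eventually_elim simp
  have ai: "integrable M (approx n t)"
    using Bochner_Integration.integrable_diff[OF Y_int[OF t] R1(1)] by simp
  have YR: "integrable M (\<lambda>\<omega>. Y s \<omega> * ?R \<omega>)"
    by (rule integrable_mult_of_squares) (use Y_second_moment s R2 in auto)
  have "{..s} \<inter> {t - int (p * n)<..t} = {}" using far by auto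
  note ind = depends_on_disjoint_mult[OF indep Y_dep[OF s] approx_depends_on this Y_int[OF s] ai]
  have "covariance M (Y s) (Y t) = expectation (\<lambda>\<omega>. Y s \<omega> * Y t \<omega>) - expectation (Y s) * expectation (Y t)"
    by (intro covariance_eq Y_int Y_mult_Y_integrable s t)
  also have "expectation (\<lambda>\<omega>. Y s \<omega> * Y t \<omega>) =
      expectation (\<lambda>\<omega>. Y s \<omega> * approx n t \<omega> + Y s \<omega> * ?R \<omega>)"
    by (simp add: algebra_simps)
  also have "\<dots> = expectation (Y s) * expectation (approx n t) + expectation (\<lambda>\<omega>. Y s \<omega> * ?R \<omega>)"
    using ind by (subst Bochner_Integration.integral_add[OF ind(1) YR]) simp
  also have "expectation (approx n t) = expectation (Y t) - expectation ?R"
    using Y_int[OF t] ai by simp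
  finally have cov: "covariance M (Y s) (Y t) =
      expectation (\<lambda>\<omega>. Y s \<omega> * ?R \<omega>) - expectation (Y s) * expectation ?R"
    by (simp add: algebra_simps)
  have "0 \<le> expectation (\<lambda>\<omega>. Y s \<omega> * ?R \<omega>)"
    using R_nonneg by (intro integral_nonneg_AE) (auto simp: Y_nonneg elim!: eventually_mono)
  moreover have "0 \<le> expectation (Y s) * expectation ?R"
    using R_nonneg by (intro mult_nonneg_nonneg integral_nonneg_AE) (auto simp: Y_nonneg)
  moreover have "expectation (Y s) * expectation ?R \<le> \<theta> ^ n * moment_bound"
  proof -
    have "expectation (Y s) * expectation ?R \<le> sqrt moment_bound * (\<theta> ^ n * sqrt moment_bound)"
      using R_nonneg moment_bound_nonneg
      by (intro mult_mono R1 Y_expectation_le s integral_nonneg_AE) auto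
    then show ?thesis using moment_bound_nonneg by (simp add: algebra_simps)
  qed
  moreover have "expectation (\<lambda>\<omega>. Y s \<omega> * ?R \<omega>) \<le> \<theta> ^ n * moment_bound"
  proof -
    let ?l = "\<theta> ^ n"
    have l: "0 < ?l" using theta by simp
    \<comment> \<open>Weighted AM-GM stands in for Cauchy-Schwarz in L2. As the second moment of the
      residual is of order \<open>l\<^sup>2\<close>, the weight \<open>l = \<theta> ^ n\<close>
      gives both halves the same bound.\<close>
    have amgm: "x * y \<le> l * x\<^sup>2 / 2 + y\<^sup>2 / (2 * l)" if "0 < l" for x y l :: real
    proof -
      have "0 \<le> (l * x - y)\<^sup>2 / (2 * l)" using that by simp
      also have "\<dots> = l * x\<^sup>2 / 2 + y\<^sup>2 / (2 * l) - x * y"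
        using that by (simp add: power2_eq_square divide_simps) (simp add: algebra_simps)
      finally show ?thesis by simp
    qed
    note Y2 = Y_second_moment[OF s]
    have "expectation (\<lambda>\<omega>. Y s \<omega> * ?R \<omega>) \<le> expectation (\<lambda>\<omega>. ?l * (Y s \<omega>)\<^sup>2 / 2 + (?R \<omega>)\<^sup>2 / (2 * ?l))"
      using Y2(1) R2(1) YR by (intro integral_mono amgm[OF l]) auto
    also have "\<dots> = ?l * expectation (\<lambda>\<omega>. (Y s \<omega>)\<^sup>2) / 2 + expectation (\<lambda>\<omega>. (?R \<omega>)\<^sup>2) / (2 * ?l)"
      using Y2(1) R2(1) by simp
    also have "\<dots> \<le> ?l * moment_bound / 2 + (?l\<^sup>2 * moment_bound) / (2 * ?l)"
      using Y2(2) R2(2) l by (intro add_mono divide_right_mono mult_left_mono) auto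
    also have "\<dots> = ?l * moment_bound" using l by (simp add: power2_eq_square)
    finally show ?thesis .
  qed
  ultimately show ?thesis unfolding cov by linarith
qed

end

section \<open>Right limits of the parameter functions and the geometric rate\<close>

text \<open>\<open>Lim\<close> is meaningful only if a limit exists. Hoelder continuity gives
  uniform continuity on the half-open interval, hence a limit at its missing endpoint 0.\<close>

lemma Lim_at_right_0:
  fixes f :: "real \<Rightarrow> real"
  assumes "0 < \<beta>" "0 < K"
    and hol: "\<And>u v. u \<in> {0<..1} \<Longrightarrow> v \<in> {0<..1} \<Longrightarrow> \<bar>f u - f v\<bar> \<le> K * \<bar>u - v\<bar> powr \<beta>"
  shows "(f \<longlongrightarrow> Lim (at_right 0) f) (at_right 0)"
proof -
  have "uniformly_continuous_on {0<..1} f"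
    unfolding uniformly_continuous_on_def
  proof (intro allI impI)
    fix e :: real assume e: "0 < e"
    \<comment> \<open>\<open>?d\<close> solves \<open>K * ?d powr \<beta> = e\<close>.\<close>
    let ?d = "(e / K) powr (1 / \<beta>)"
    have "dist (f v) (f u) < e" if "u \<in> {0<..1}" "v \<in> {0<..1}" "dist v u < ?d" for u v
    proof -
      have "K * \<bar>v - u\<bar> powr \<beta> < K * (?d powr \<beta>)"
        using that assms(1,2) by (intro mult_strict_left_mono powr_less_mono2) (auto simp: dist_real_def)
      also have "\<dots> = e" using assms(1,2) e by (simp add: powr_powr)
      finally show ?thesis using hol[OF that(2,1)] by (simp add: dist_real_def)
    qed
    moreover have "0 < ?d" using e assms(2) by simp
    ultimately show "\<exists>d>0. \<forall>u\<in>{0<..1}. \<forall>v\<in>{0<..1}. dist v u < d \<longrightarrow> dist (f v) (f u) < e"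
      by blast
  qed
  then obtain l where "(f \<longlongrightarrow> l) (at 0 within {0<..1})"
    by (rule uniformly_continuous_on_extension_at_closure[of _ _ 0]) auto
  moreover have "at 0 within {0<..1} = at_right (0::real)"
    by (rule at_within_nhd[of _ "{..<1}"]) auto
  ultimately have "(f \<longlongrightarrow> l) (at_right 0)" by simp
  then show ?thesis using tendsto_Lim trivial_limit_at_right_real by metis
qed

text \<open>Rounding \<open>h / p\<close> down costs at most one power of \<open>\<theta>\<close>,
  which the division by \<open>\<theta>\<close> pays for; \<open>root p \<theta>\<close> is the rate
  per unit of time.\<close>

lemma root_power_div_bound:
  fixes \<theta> :: real
  assumes "0 < \<theta>" "\<theta> < 1" "1 \<le> p"
  shows "\<theta> ^ (h div p) \<le> root p \<theta> ^ h / \<theta>"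
proof -
  let ?r = "root p \<theta>"
  have r: "0 < ?r" "?r < 1" "?r ^ p = \<theta>" using assms by auto
  have "\<theta> ^ (h div p) * \<theta> = ?r ^ (p * (h div p) + p)"
    using r(3) by (simp add: power_add power_mult)
  also have "\<dots> \<le> ?r ^ h"
  proof (rule power_decreasing)
    have "h mod p \<le> p" using assms(3) by (intro less_imp_le mod_less_divisor) simp
    then show "h \<le> p * (h div p) + p" using mult_div_mod_eq[of p h] by linarith
  qed (use r in auto)
  finally show ?thesis using assms by (simp add: field_simps)
qed

text \<open>Frozen and sampled coefficients alike are limits of values on \<open>(0,1]\<close>, so
  non-strict bounds carry over to them. The sequence \<open>u\<close> is fixed before
  \<open>f\<close>, hence serves all coefficients at once, as is required to bound their
  sum.\<close>

lemma tv_coeff_limit: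
  assumes "1 \<le> N" "t \<le> int N"
  obtains u where "\<And>n :: nat. u n \<in> {0<..1}"
    and "\<And>f. (f \<longlongrightarrow> Lim (at_right 0) f) (at_right 0) \<Longrightarrow> (\<lambda>n. f (u n)) \<longlonglongrightarrow> tv_coeff f N t"
proof (cases "t \<le> 0")
  case True
  have "filterlim (\<lambda>n. inverse (real (Suc n))) (at_right 0) sequentially"
    by (rule tendsto_imp_filterlim_at_right[OF LIMSEQ_inverse_real_of_nat]) simp
  then have "(\<lambda>n. f (inverse (real (Suc n)))) \<longlonglongrightarrow> tv_coeff f N t"
    if "(f \<longlongrightarrow> Lim (at_right 0) f) (at_right 0)" for f
    using that True by (auto simp: tv_coeff_def intro: filterlim_compose)
  moreover have "inverse (real (Suc n)) \<in> {0<..1}" for n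
    by (simp add: inverse_eq_divide)
  ultimately show ?thesis using that[of "\<lambda>n. inverse (real (Suc n))"] by blast
next
  case False
  have "real_of_int t / real N \<in> {0<..1}" using False assms by auto
  moreover have "(\<lambda>n::nat. f (real_of_int t / real N)) \<longlonglongrightarrow> tv_coeff f N t" for f
    using False by (simp add: tv_coeff_def)
  ultimately show ?thesis using that[of "\<lambda>n. real_of_int t / real N"] by blast
qed

section \<open>The squared tvARCH process as an instance of the row model\<close>

text \<open>Causality is indexed by lags \<open>k\<close>, while the independence arguments use time
  indices. Passing to \<open>t - int k\<close> loses nothing under restriction to
  \<open>{..t}\<close>, since \<open>t - int k \<le> t\<close>.\<close>

lemma (in tvARCH) X_depends_on_past:
  assumes "1 \<le> N" "t \<le> int N"
  shows "depends_on Z {..t} (X N t)"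
proof -
  obtain g where g: "g \<in> borel_measurable (\<Pi>\<^sub>M k\<in>(UNIV :: nat set). (borel :: real measure))"
    "AE \<omega> in M. X N t \<omega> = g (\<lambda>k. Z (t - int k) \<omega>)"
    using X_causal[OF assms] by blast
  have "(\<lambda>x :: int \<Rightarrow> real. \<lambda>k\<in>(UNIV :: nat set). x (t - int k)) \<in>
      measurable (\<Pi>\<^sub>M i\<in>{..t}. borel) (\<Pi>\<^sub>M k\<in>UNIV. borel)"
    by (intro measurable_restrict measurable_component_singleton) auto
  then have "(\<lambda>x. g (\<lambda>k. x (t - int k))) \<in> borel_measurable (\<Pi>\<^sub>M i\<in>{..t}. borel)"
    unfolding restrict_UNIV by (rule measurable_compose[OF _ g(1)])
  moreover have "AE \<omega> in M. X N t \<omega> = g (\<lambda>k. (\<lambda>i\<in>{..t}. Z i \<omega>) (t - int k))"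
    using g(2) by simp
  ultimately show ?thesis
    unfolding depends_on_def by (intro bexI[of _ "\<lambda>x. g (\<lambda>k. x (t - int k))"])
qed

lemma (in tvARCH) Z_power4:
  assumes "integrable M (\<lambda>\<omega>. Z 0 \<omega> ^ 4)"
  shows "integrable M (\<lambda>\<omega>. Z t \<omega> ^ 4)"
    and "expectation (\<lambda>\<omega>. Z t \<omega> ^ 4) = expectation (\<lambda>\<omega>. Z 0 \<omega> ^ 4)"
proof -
  have [measurable]: "Z s \<in> borel_measurable M" for s using Z_integrable by auto
  have i: "integrable M (\<lambda>\<omega>. Z s \<omega> ^ 4) \<longleftrightarrow> integrable (distr M borel (Z s)) (\<lambda>x. x ^ 4)" for s
    by (subst integrable_distr_eq) auto
  have e: "expectation (\<lambda>\<omega>. Z s \<omega> ^ 4) = integral\<^sup>L (distr M borel (Z s)) (\<lambda>x. x ^ 4)" for s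
    by (subst integral_distr) auto
  show "integrable M (\<lambda>\<omega>. Z t \<omega> ^ 4)"
    using assms unfolding i Z_ident[of t 0] .
  show "expectation (\<lambda>\<omega>. Z t \<omega> ^ 4) = expectation (\<lambda>\<omega>. Z 0 \<omega> ^ 4)"
    unfolding e Z_ident[of t 0] ..
qed

text \<open>The coefficient bounds come from the parameter functions by
  \<open>tv_coeff_limit\<close>, the recursion is the square of \<open>X_eq\<close> with
  \<open>\<sigma>_eq\<close> inserted, and causality supplies the dependence on the past.\<close>

lemma (in tvARCH) squared_row:
  assumes "1 \<le> p" "1 \<le> N"
    and lim: "\<And>j. j \<le> p \<Longrightarrow> (a j \<longlongrightarrow> Lim (at_right 0) (a j)) (at_right 0)"
    and a_0: "\<And>u. u \<in> {0<..1} \<Longrightarrow> a 0 u \<le> \<rho>2"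
    and a_sum: "\<And>u. u \<in> {0<..1} \<Longrightarrow> (\<Sum>j=1..p. a j u) \<le> S"
    and \<theta>: "0 < \<theta>" "\<theta> < 1" "integrable M (\<lambda>\<omega>. Z 0 \<omega> ^ 4)"
      "expectation (\<lambda>\<omega>. Z 0 \<omega> ^ 4) * S\<^sup>2 \<le> \<theta>\<^sup>2"
  shows "squared_arch_row M Z p (int N) (\<lambda>j t. tv_coeff (a j) N t) (\<lambda>t \<omega>. (X N t \<omega>)\<^sup>2)
    \<rho>2 S \<theta> (expectation (\<lambda>\<omega>. Z 0 \<omega> ^ 4))"
proof (unfold_locales, goal_cases)
  case 1
  show ?case by fact
next
  case (6 t)
  show ?case by (rule Z_power4(2)[OF \<theta>(3)])
next
  case 9
  have "0 \<le> (\<Sum>j=1..p. a j 1)" by (intro sum_nonneg coeff_nonneg) auto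
  then show ?case using a_sum[of 1] by simp
next
  case (11 j t)
  obtain u where u: "\<And>n :: nat. u n \<in> {0<..1}"
    "\<And>f. (f \<longlongrightarrow> Lim (at_right 0) f) (at_right 0) \<Longrightarrow> (\<lambda>n. f (u n)) \<longlonglongrightarrow> tv_coeff f N t"
    using tv_coeff_limit[OF \<open>1 \<le> N\<close> \<open>t \<le> int N\<close>] by blast
  show ?case
    by (rule LIMSEQ_le_const[OF u(2)[OF lim]]) (use 11 u(1) in \<open>auto intro!: coeff_nonneg\<close>)
next
  case (12 t)
  obtain u where u: "\<And>n :: nat. u n \<in> {0<..1}"
    "\<And>f. (f \<longlongrightarrow> Lim (at_right 0) f) (at_right 0) \<Longrightarrow> (\<lambda>n. f (u n)) \<longlonglongrightarrow> tv_coeff f N t"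
    using tv_coeff_limit[OF \<open>1 \<le> N\<close> \<open>t \<le> int N\<close>] by blast
  show ?case
    by (rule LIMSEQ_le_const2[OF u(2)[OF lim]]) (use a_0 u(1) in auto)
next
  case (13 t)
  obtain u where u: "\<And>n :: nat. u n \<in> {0<..1}"
    "\<And>f. (f \<longlongrightarrow> Lim (at_right 0) f) (at_right 0) \<Longrightarrow> (\<lambda>n. f (u n)) \<longlonglongrightarrow> tv_coeff f N t"
    using tv_coeff_limit[OF \<open>1 \<le> N\<close> \<open>t \<le> int N\<close>] by blast
  have "(\<lambda>n. \<Sum>j=1..p. a j (u n)) \<longlonglongrightarrow> (\<Sum>j=1..p. tv_coeff (a j) N t)"
    by (intro tendsto_sum u(2) lim) auto
  then show ?case
    by (rule LIMSEQ_le_const2) (use a_sum u(1) in auto)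
next
  case (15 t)
  show ?case by (rule X_square_integrable[OF \<open>1 \<le> N\<close> 15])
next
  case (16 t)
  show ?case
    using X_eq[OF \<open>1 \<le> N\<close> 16] \<sigma>_eq[OF \<open>1 \<le> N\<close> 16]
    by eventually_elim (simp add: power_mult_distrib mult.commute)
next
  case (17 t)
  show ?case by (intro depends_on_power2 X_depends_on_past \<open>1 \<le> N\<close> 17)
next
  case 18
  show ?case using X_second_moment_bounded[OF \<open>1 \<le> N\<close>] by blast
qed (simp_all add: \<theta> Z_indep Z_square_integrable Z_second_moment Z_power4(1)[OF \<theta>(3)])

section \<open>Uniform covariance decay over all rows\<close>

theorem proposition1:
  fixes M :: "'a measure"
    and p :: nat
    and a :: "nat \<Rightarrow> real \<Rightarrow> real"
    and Z :: "int \<Rightarrow> 'a \<Rightarrow> real"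
    and \<sigma> X :: "nat \<Rightarrow> int \<Rightarrow> 'a \<Rightarrow> real"
    and \<delta> :: real
  assumes "1 \<le> p"
    and "tvARCH M p a Z \<sigma> X"
    and "\<exists>\<rho>1 \<rho>2 \<delta>0. 0 < \<rho>1 \<and> \<rho>1 \<le> \<rho>2 \<and> 0 < \<delta>0 \<and> \<delta>0 < 1 \<and>
          (\<forall>u\<in>{0<..1}. \<rho>1 \<le> a 0 u \<and> a 0 u \<le> \<rho>2) \<and>
          (SUP u\<in>{0<..1}. \<Sum>j=1..p. a j u) \<le> 1 - \<delta>0"
    and "\<exists>\<beta> K0. 0 < \<beta> \<and> \<beta> \<le> 1 \<and> 0 < K0 \<and>
          (\<forall>j\<le>p. \<forall>u\<in>{0<..1}. \<forall>v\<in>{0<..1}. \<bar>a j u - a j v\<bar> \<le> K0 * \<bar>u - v\<bar> powr \<beta>)"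
    and "0 < \<delta>" and "\<delta> < 1"
    and "integrable M (\<lambda>\<omega>. (Z 0 \<omega>) ^ 4)"
    and "sqrt (integral\<^sup>L M (\<lambda>\<omega>. (Z 0 \<omega>) ^ 4)) * (SUP u\<in>{0<..1}. \<Sum>j=1..p. a j u) \<le> 1 - \<delta>"
  shows "\<exists>\<rho> K. 1 - \<delta> < \<rho> \<and> \<rho> < 1 \<and> 0 < K \<and>
          (\<forall>h :: nat.
            (\<forall>N t. 1 \<le> t \<and> t + int h \<le> int N \<longrightarrow>
               integrable M (\<lambda>\<omega>. (X N t \<omega>)\<^sup>2 * (X N (t + int h) \<omega>)\<^sup>2)) \<and>
            (SUP (N, t) \<in> {(N, t). 1 \<le> t \<and> t + int h \<le> int N}.
               ereal \<bar>covariance M (\<lambda>\<omega>. (X N t \<omega>)\<^sup>2) (\<lambda>\<omega>. (X N (t + int h) \<omega>)\<^sup>2)\<bar>)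
              \<le> ereal (K * \<rho> ^ h))"
proof -
  interpret tvARCH M p a Z \<sigma> X by fact
  define S where "S = (SUP u\<in>{0<..1}. \<Sum>j=1..p. a j u)"
  define \<kappa> where "\<kappa> = expectation (\<lambda>\<omega>. Z 0 \<omega> ^ 4)"
  define \<theta> where "\<theta> = 1 - \<delta>"
  have \<theta>: "0 < \<theta>" "\<theta> < 1" using assms(5,6) by (auto simp: \<theta>_def)
  obtain \<rho>2 where \<rho>2: "\<And>u. u \<in> {0<..1} \<Longrightarrow> a 0 u \<le> \<rho>2" using assms(3) by blast
  obtain \<beta> K0 where hol: "0 < \<beta>" "\<beta> \<le> 1" "0 < K0"
    "\<And>j u v. j \<le> p \<Longrightarrow> u \<in> {0<..1} \<Longrightarrow> v \<in> {0<..1} \<Longrightarrow> \<bar>a j u - a j v\<bar> \<le> K0 * \<bar>u - v\<bar> powr \<beta>"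
    using assms(4) by blast
  have lim: "(a j \<longlongrightarrow> Lim (at_right 0) (a j)) (at_right 0)" if "j \<le> p" for j
    by (rule Lim_at_right_0[OF hol(1,3) hol(4)[OF that]])
  \<comment> \<open>A real \<open>SUP\<close> is known to dominate its members only when they are
    bounded above. Comparison with the value at 1, at distance less than 1, derives such a bound
    from Hoelder continuity.\<close>
  have a_le: "a j u \<le> a j 1 + K0" if "j \<le> p" "u \<in> {0<..1}" for j u
  proof -
    have "\<bar>u - 1\<bar> powr \<beta> \<le> 1" using that(2) hol(1) by (intro powr_le1) auto
    then have "K0 * \<bar>u - 1\<bar> powr \<beta> \<le> K0" using hol(3) by simp
    then show ?thesis using hol(4)[OF that, of 1] by auto
  qed
  have "bdd_above ((\<lambda>u. \<Sum>j=1..p. a j u) ` {0<..1})"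
    by (rule bdd_aboveI2[of _ _ "\<Sum>j=1..p. a j 1 + K0"]) (auto intro!: sum_mono a_le)
  then have a_sum: "(\<Sum>j=1..p. a j u) \<le> S" if "u \<in> {0<..1}" for u
    unfolding S_def using that by (rule cSUP_upper[rotated])
  have "0 \<le> (\<Sum>j=1..p. a j 1)" by (intro sum_nonneg coeff_nonneg) auto
  then have S: "0 \<le> S" using a_sum[of 1] by simp
  have "0 \<le> \<kappa>" unfolding \<kappa>_def by simp
  \<comment> \<open>The moment condition may be squared because \<open>\<kappa>\<close> and
    \<open>S\<close> are nonnegative.\<close>
  moreover have "(sqrt \<kappa> * S)\<^sup>2 \<le> \<theta>\<^sup>2"
    using assms(8) S \<open>0 \<le> \<kappa>\<close> by (intro power_mono) (auto simp: S_def \<kappa>_def \<theta>_def)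
  ultimately have \<kappa>S: "\<kappa> * S\<^sup>2 \<le> \<theta>\<^sup>2" by (simp add: power_mult_distrib)
  have row: "squared_arch_row M Z p (int N) (\<lambda>j t. tv_coeff (a j) N t) (\<lambda>t \<omega>. (X N t \<omega>)\<^sup>2)
    \<rho>2 S \<theta> \<kappa>" if "1 \<le> N" for N
    unfolding \<kappa>_def by (rule squared_row) (use assms(1,7) that lim \<rho>2 a_sum \<theta> \<kappa>S in \<open>auto simp: \<kappa>_def\<close>)
  \<comment> \<open>This is \<open>moment_bound\<close> written out: \<open>K\<close> has to be
    chosen before \<open>N\<close>, and the formula involves nothing that depends on the
    row.\<close>
  define C where "C = \<kappa> * (1 + 1 / (1 - \<theta>)) * \<rho>2\<^sup>2 / (1 - \<theta>)"
  have C: "0 \<le> C" unfolding C_def using \<open>0 \<le> \<kappa>\<close> \<theta> by auto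
  define r where "r = root p \<theta>"
  have r: "0 < r" "r < 1" using \<theta> assms(1) by (auto simp: r_def)
  have "r ^ p \<le> r ^ 1" using r assms(1) by (intro power_decreasing) auto
  then have "\<theta> \<le> r" using \<theta> assms(1) by (simp add: r_def)
  \<comment> \<open>For \<open>p = 1\<close> the root \<open>r\<close> equals
    \<open>1 - \<delta>\<close>, whereas a strictly larger rate is required. The midpoint between
    \<open>r\<close> and 1 is strictly larger for every \<open>p\<close>.\<close>
  define \<rho> where "\<rho> = (1 + r) / 2"
  have \<rho>: "1 - \<delta> < \<rho>" "\<rho> < 1" "r \<le> \<rho>"
    using \<open>\<theta> \<le> r\<close> r by (auto simp: \<rho>_def \<theta>_def)
  \<comment> \<open>The division by \<open>\<theta>\<close> comes from
    \<open>root_power_div_bound\<close>; adding 1 makes \<open>K\<close> positive knowing only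
    \<open>0 \<le> C\<close>.\<close>
  define K where "K = C / \<theta> + 1"
  have K: "0 < K" using C \<theta> by (simp add: K_def add_nonneg_pos)
  have main: "integrable M (\<lambda>\<omega>. (X N t \<omega>)\<^sup>2 * (X N (t + int h) \<omega>)\<^sup>2)"
    "\<bar>covariance M (\<lambda>\<omega>. (X N t \<omega>)\<^sup>2) (\<lambda>\<omega>. (X N (t + int h) \<omega>)\<^sup>2)\<bar> \<le> K * \<rho> ^ h"
    if "1 \<le> t" "t + int h \<le> int N" for N t h
  proof -
    have N: "1 \<le> N" using that by simp
    interpret row: squared_arch_row M Z p "int N" "\<lambda>j t. tv_coeff (a j) N t" "\<lambda>t \<omega>. (X N t \<omega>)\<^sup>2"
      \<rho>2 S \<theta> \<kappa> by (rule row[OF N])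
    show "integrable M (\<lambda>\<omega>. (X N t \<omega>)\<^sup>2 * (X N (t + int h) \<omega>)\<^sup>2)"
      using that by (intro row.Y_mult_Y_integrable) auto
    have "p * (h div p) \<le> h" by simp
    then have "t \<le> t + int h - int (p * (h div p))" by linarith
    then have "\<bar>covariance M (\<lambda>\<omega>. (X N t \<omega>)\<^sup>2) (\<lambda>\<omega>. (X N (t + int h) \<omega>)\<^sup>2)\<bar> \<le> \<theta> ^ (h div p) * C"
      using row.abs_covariance_le[of t "t + int h" "h div p"] that
      unfolding row.moment_bound_def C_def by linarith
    also have "\<dots> \<le> (r ^ h / \<theta>) * C"
      unfolding r_def by (intro mult_right_mono root_power_div_bound \<theta> assms(1) C)
    also have "\<dots> = (C / \<theta>) * r ^ h" by simp
    also have "\<dots> \<le> K * \<rho> ^ h"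
      using C \<theta> r \<rho>(3) by (intro mult_mono power_mono) (auto simp: K_def)
    finally show "\<bar>covariance M (\<lambda>\<omega>. (X N t \<omega>)\<^sup>2) (\<lambda>\<omega>. (X N (t + int h) \<omega>)\<^sup>2)\<bar> \<le> K * \<rho> ^ h" .
  qed
  show ?thesis
  proof (rule exI[of _ \<rho>], rule exI[of _ K], intro conjI allI impI)
    show "1 - \<delta> < \<rho>" "\<rho> < 1" "0 < K" by (rule \<rho> K)+
    show "integrable M (\<lambda>\<omega>. (X N t \<omega>)\<^sup>2 * (X N (t + int h) \<omega>)\<^sup>2)"
      if "1 \<le> t \<and> t + int h \<le> int N" for h N t
      using that by (blast intro: main(1))
    show "(SUP (N, t) \<in> {(N, t). 1 \<le> t \<and> t + int h \<le> int N}.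
        ereal \<bar>covariance M (\<lambda>\<omega>. (X N t \<omega>)\<^sup>2) (\<lambda>\<omega>. (X N (t + int h) \<omega>)\<^sup>2)\<bar>)
      \<le> ereal (K * \<rho> ^ h)" for h
      by (rule SUP_least, clarify, unfold ereal_less_eq) (rule main(2))
  qed
qed

end
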